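(* Let $f(t)\in\mathbb{Z}[t]$ be a nonzero polynomial. Then $f(t)$, regarded as an element of the completed group ring $\widehat{\mathbb{Z}}[[t^{\widehat{\mathbb{Z}}}]]$, is not a zero-divisor in $\widehat{\mathbb{Z}}[[t^{\widehat{\mathbb{Z}}}]]$.
   Context: $\widehat{\mathbb{Z}}=\varprojlim_n\mathbb{Z}/n\mathbb{Z}$ is the ring of profinite integers. The completed group ring is $\widehat{\mathbb{Z}}[[t^{\widehat{\mathbb{Z}}}]]:=\varprojlim_n\widehat{\mathbb{Z}}[t^{\mathbb{Z}/n\mathbb{Z}}]$, identified with $\varprojlim_n\widehat{\mathbb{Z}}[t]/(t^n-1)$, where $n$ runs over positive integers ordered by divisibility and the transition maps are the natural ones. $\mathbb{Z}[t]$ is regarded as a subring via the natural injection $f(t)\mapsto (f(t)\bmod (t^n-1))_n$. *)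

theory Defs
  imports "HOL-Computational_Algebra.Polynomial" "HOL-Number_Theory.Cong"
begin

(* An element of an inverse limit of quotient rings R_n / I_n is a compatible family of residue
   classes. Both limits below are built as families of representatives x n, compatible along the
   transition maps, with two families identified iff they are congruent modulo I_n at every n;
   the ring operations are pointwise. The value at n = 0 is junk: only positive n are indices.
   (Admitting 0, which every n divides, would add a top element to the index poset and collapse
   the limit.) *)

definition zhat_family :: "(nat \<Rightarrow> int) \<Rightarrow> bool" where
  "zhat_family x \<longleftrightarrow> (\<forall>m>0. \<forall>n>0. n dvd m \<longrightarrow> [x m = x n] (mod int n))"

definition zhat_rel :: "(nat \<Rightarrow> int) \<Rightarrow> (nat \<Rightarrow> int) \<Rightarrow> bool" where
  "zhat_rel x y \<longleftrightarrow> zhat_family x \<and> zhat_family y \<and> (\<forall>n>0. [x n = y n] (mod int n))"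

quotient_type zhat = "nat \<Rightarrow> int" / partial: zhat_rel
proof (rule part_equivpI)
  show "\<exists>x. zhat_rel x x"
    by (rule exI[of _ "\<lambda>_. 0"]) (simp add: zhat_rel_def zhat_family_def)
  show "symp zhat_rel"
    by (auto simp: symp_def zhat_rel_def cong_sym_eq)
  show "transp zhat_rel"
    unfolding transp_def zhat_rel_def by (meson cong_trans)
qed

instantiation zhat :: comm_ring_1
begin

lift_definition zero_zhat :: zhat is "\<lambda>_. 0"
  by (simp add: zhat_rel_def zhat_family_def)

lift_definition one_zhat :: zhat is "\<lambda>_. 1"
  by (simp add: zhat_rel_def zhat_family_def)

lift_definition plus_zhat :: "zhat \<Rightarrow> zhat \<Rightarrow> zhat" is "\<lambda>x y n. x n + y n"
  by (simp add: zhat_rel_def zhat_family_def cong_add)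

lift_definition minus_zhat :: "zhat \<Rightarrow> zhat \<Rightarrow> zhat" is "\<lambda>x y n. x n - y n"
  by (simp add: zhat_rel_def zhat_family_def cong_diff)

lift_definition uminus_zhat :: "zhat \<Rightarrow> zhat" is "\<lambda>x n. - x n"
  by (simp add: zhat_rel_def zhat_family_def cong_minus_minus_iff)

lift_definition times_zhat :: "zhat \<Rightarrow> zhat \<Rightarrow> zhat" is "\<lambda>x y n. x n * y n"
  by (simp add: zhat_rel_def zhat_family_def cong_mult)

instance
proof
  show "(0::zhat) \<noteq> 1"
  proof transfer
    have "\<not> [0 = 1] (mod int 2)"
      by (simp add: cong_def)
    then show "\<not> zhat_rel (\<lambda>_. 0) (\<lambda>_. 1)"
      unfolding zhat_rel_def by (meson zero_less_numeral)
  qed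
next
  fix a b c :: zhat
  show "a * b * c = a * (b * c)"
    by transfer (simp add: zhat_rel_def zhat_family_def cong_mult mult.assoc)
  show "a * b = b * a"
    by transfer (simp add: zhat_rel_def zhat_family_def cong_mult mult.commute)
  show "1 * a = a"
    by transfer (simp add: zhat_rel_def)
  show "(a + b) * c = a * c + b * c"
    by transfer (simp add: zhat_rel_def zhat_family_def cong_mult cong_add distrib_right)
  show "a + b + c = a + (b + c)"
    by transfer (simp add: zhat_rel_def zhat_family_def cong_add add.assoc)
  show "a + b = b + a"
    by transfer (simp add: zhat_rel_def zhat_family_def cong_add add.commute)
  show "0 + a = a"
    by transfer (simp add: zhat_rel_def)
  show "- a + a = 0"
    by transfer (simp add: zhat_rel_def zhat_family_def)
  show "a - b = a + - b"
    by transfer (simp add: zhat_rel_def zhat_family_def cong_diff)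
qed

end

(* The defining polynomial of the level-n quotient; Zhat[t]/(t^n - 1) is the group ring of Z/nZ
   over Zhat. For n dvd m, t^n - 1 divides t^m - 1, so the transition map from level m to level n
   is reduction modulo t^n - 1. *)

definition cyc_poly :: "nat \<Rightarrow> zhat poly" where
  "cyc_poly n = monom 1 n - 1"

definition cgr_family :: "(nat \<Rightarrow> zhat poly) \<Rightarrow> bool" where
  "cgr_family g \<longleftrightarrow> (\<forall>m>0. \<forall>n>0. n dvd m \<longrightarrow> cyc_poly n dvd g m - g n)"

definition cgr_rel :: "(nat \<Rightarrow> zhat poly) \<Rightarrow> (nat \<Rightarrow> zhat poly) \<Rightarrow> bool" where
  "cgr_rel g h \<longleftrightarrow> cgr_family g \<and> cgr_family h \<and> (\<forall>n>0. cyc_poly n dvd g n - h n)"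

lemma dvd_add_diff:
  fixes d :: "'a :: comm_ring_1"
  assumes "d dvd a - b" "d dvd a' - b'"
  shows "d dvd (a + a') - (b + b')"
  using dvd_add[OF assms] by (simp add: algebra_simps)

lemma dvd_diff_diff:
  fixes d :: "'a :: comm_ring_1"
  assumes "d dvd a - b" "d dvd a' - b'"
  shows "d dvd (a - a') - (b - b')"
  using dvd_diff[OF assms] by (simp add: algebra_simps)

lemma dvd_uminus_diff:
  fixes d :: "'a :: comm_ring_1"
  assumes "d dvd a - b"
  shows "d dvd (- a) - (- b)"
  using dvd_diff_diff[OF _ assms, of 0 0] by simp

lemma dvd_mult_diff:
  fixes d :: "'a :: comm_ring_1"
  assumes "d dvd a - b" "d dvd a' - b'"
  shows "d dvd a * a' - b * b'"
proof -
  have "a * a' - b * b' = (a - b) * a' + b * (a' - b')"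
    by (simp add: algebra_simps)
  then show ?thesis
    using assms by simp
qed

(* The completed group ring Zhat[[t^Zhat]]. *)
quotient_type zhat_cgr = "nat \<Rightarrow> zhat poly" / partial: cgr_rel
proof (rule part_equivpI)
  show "\<exists>g. cgr_rel g g"
    by (rule exI[of _ "\<lambda>_. 0"]) (simp add: cgr_rel_def cgr_family_def)
  show "symp cgr_rel"
    by (auto simp: symp_def cgr_rel_def) (metis dvd_minus_iff minus_diff_eq)
  show "transp cgr_rel"
    unfolding transp_def cgr_rel_def
  proof (intro allI impI conjI; elim conjE)
    fix x y z :: "nat \<Rightarrow> zhat poly" and n :: nat
    assume "\<forall>n>0. cyc_poly n dvd x n - y n" "\<forall>n>0. cyc_poly n dvd y n - z n" "0 < n"
    then have "cyc_poly n dvd (x n - y n) + (y n - z n)"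
      by (intro dvd_add) auto
    then show "cyc_poly n dvd x n - z n"
      by simp
  qed
qed

instantiation zhat_cgr :: comm_ring_1
begin

lift_definition zero_zhat_cgr :: zhat_cgr is "\<lambda>_. 0"
  by (simp add: cgr_rel_def cgr_family_def)

lift_definition one_zhat_cgr :: zhat_cgr is "\<lambda>_. 1"
  by (simp add: cgr_rel_def cgr_family_def)

lift_definition plus_zhat_cgr :: "zhat_cgr \<Rightarrow> zhat_cgr \<Rightarrow> zhat_cgr" is "\<lambda>g h n. g n + h n"
  by (simp add: cgr_rel_def cgr_family_def dvd_add_diff)

lift_definition minus_zhat_cgr :: "zhat_cgr \<Rightarrow> zhat_cgr \<Rightarrow> zhat_cgr" is "\<lambda>g h n. g n - h n"
  by (simp add: cgr_rel_def cgr_family_def dvd_diff_diff)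

lift_definition uminus_zhat_cgr :: "zhat_cgr \<Rightarrow> zhat_cgr" is "\<lambda>g n. - g n"
  unfolding cgr_rel_def cgr_family_def by (intro conjI allI impI; intro dvd_uminus_diff; simp)

lift_definition times_zhat_cgr :: "zhat_cgr \<Rightarrow> zhat_cgr \<Rightarrow> zhat_cgr" is "\<lambda>g h n. g n * h n"
  by (simp add: cgr_rel_def cgr_family_def dvd_mult_diff)

instance
proof
  show "(0::zhat_cgr) \<noteq> 1"
  proof transfer
    have "\<not> cyc_poly 1 dvd 0 - 1"
    proof
      assume "cyc_poly 1 dvd 0 - 1"
      then obtain q where "0 - 1 = cyc_poly 1 * q" ..
      from arg_cong[OF this, of "\<lambda>p. poly p 1"] show False
        by (simp add: cyc_poly_def poly_monom)
    qed
    then show "\<not> cgr_rel (\<lambda>_. 0) (\<lambda>_. 1)"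
      by (auto simp: cgr_rel_def intro!: exI[of _ 1])
  qed
next
  fix a b c :: zhat_cgr
  show "a * b * c = a * (b * c)"
    by transfer (simp add: cgr_rel_def cgr_family_def dvd_mult_diff mult.assoc)
  show "a * b = b * a"
    by transfer (simp add: cgr_rel_def cgr_family_def dvd_mult_diff mult.commute)
  show "1 * a = a"
    by transfer (simp add: cgr_rel_def)
  show "(a + b) * c = a * c + b * c"
    by transfer (simp add: cgr_rel_def cgr_family_def dvd_mult_diff dvd_add_diff distrib_right)
  show "a + b + c = a + (b + c)"
    by transfer (simp add: cgr_rel_def cgr_family_def dvd_add_diff add.assoc)
  show "a + b = b + a"
    by transfer (simp add: cgr_rel_def cgr_family_def dvd_add_diff add.commute)
  show "0 + a = a"
    by transfer (simp add: cgr_rel_def)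
  show "- a + a = 0"
    by transfer (simp add: cgr_rel_def cgr_family_def)
  show "a - b = a + - b"
    by transfer (simp add: cgr_rel_def cgr_family_def dvd_diff_diff)
qed

end

(* The natural map Z[t] -> Zhat[[t^Zhat]], f |-> (f mod (t^n - 1))_n. *)
lift_definition cgr_of_int_poly :: "int poly \<Rightarrow> zhat_cgr" is "\<lambda>f n. map_poly of_int f"
  by (simp add: cgr_rel_def cgr_family_def)

lemma cgr_of_int_poly_eq: "cgr_of_int_poly f = abs_zhat_cgr (\<lambda>_. map_poly of_int f)"
  by (simp add: cgr_of_int_poly_def)

lemma cgr_rel_const: "cgr_rel (\<lambda>_. p) (\<lambda>_. p)"
  by (simp add: cgr_rel_def cgr_family_def)

lemma cgr_of_int_poly_1: "cgr_of_int_poly 1 = 1"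
  by (simp add: cgr_of_int_poly_eq one_zhat_cgr_def)

lemma cgr_of_int_poly_add: "cgr_of_int_poly (f + g) = cgr_of_int_poly f + cgr_of_int_poly g"
proof -
  have "map_poly of_int (f + g) = (map_poly of_int f + map_poly of_int g :: zhat poly)"
    by (rule poly_eqI) (simp add: coeff_map_poly)
  then show ?thesis
    by (simp add: cgr_of_int_poly_eq plus_zhat_cgr.abs_eq cgr_rel_const)
qed

lemma cgr_of_int_poly_mult: "cgr_of_int_poly (f * g) = cgr_of_int_poly f * cgr_of_int_poly g"
proof -
  have "map_poly of_int (f * g) = (map_poly of_int f * map_poly of_int g :: zhat poly)"
    by (rule poly_eqI) (simp add: coeff_map_poly coeff_mult)
  then show ?thesis
    by (simp add: cgr_of_int_poly_eq times_zhat_cgr.abs_eq cgr_rel_const)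
qed

lemma zhat_of_int_eq_0_iff: "(of_int k :: zhat) = 0 \<longleftrightarrow> k = 0"
proof
  assume k: "(of_int k :: zhat) = 0"
  define c where "c = (\<lambda>j::int. abs_zhat (\<lambda>_. j))"
  have rel: "zhat_rel (\<lambda>_. j) (\<lambda>_. j)" for j
    by (simp add: zhat_rel_def zhat_family_def)
  have c_diff: "c (i - j) = c i - c j" and c0: "c 0 = 0" and c1: "c 1 = 1" for i j
    by (simp_all add: c_def minus_zhat.abs_eq zero_zhat_def one_zhat_def rel)
  have c_add: "c (i + j) = c i + c j" for i j
    by (simp add: c_def plus_zhat.abs_eq rel)
  have "of_int j = c j" for j
    by (induction j rule: int_induct[of _ 0]) (simp_all only: c_add c_diff c0 c1 of_int_add of_int_diff of_int_0 of_int_1)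
  then have "abs_zhat (\<lambda>_. k) = abs_zhat (\<lambda>_. 0)"
    using k c0 by (metis c_def)
  then have "zhat_rel (\<lambda>_. k) (\<lambda>_. 0)"
    using Quotient_rel[OF Quotient_zhat] rel by blast
  then have "[k = 0] (mod int (Suc (nat \<bar>k\<bar>)))"
    unfolding zhat_rel_def by blast
  then have "int (Suc (nat \<bar>k\<bar>)) dvd k"
    by (simp only: cong_0_iff)
  then show "k = 0"
    using dvd_imp_le_int[of k "int (Suc (nat \<bar>k\<bar>))"] by fastforce
qed simp

lemma inj_cgr_of_int_poly: "inj cgr_of_int_poly"
proof (rule injI)
  fix f g assume eq: "cgr_of_int_poly f = cgr_of_int_poly g"
  define h where "h = (map_poly of_int f - map_poly of_int g :: zhat poly)"
  define n where "n = Suc (degree h)"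
  have "cgr_rel (\<lambda>_. map_poly of_int f) (\<lambda>_. map_poly of_int g)"
    using eq Quotient_rel[OF Quotient_zhat_cgr] cgr_rel_const
    unfolding cgr_of_int_poly_eq by blast
  then have "cyc_poly n dvd h"
    by (simp add: cgr_rel_def h_def n_def)
  then obtain q where q: "h = cyc_poly n * q" ..
  have deg: "degree (cyc_poly n) = n" and lc: "lead_coeff (cyc_poly n) = 1"
  proof -
    have "degree (- 1 :: zhat poly) < degree (monom 1 n :: zhat poly)"
      by (simp add: degree_monom_eq n_def)
    then show "degree (cyc_poly n) = n"
      unfolding cyc_poly_def by (metis degree_add_eq_left degree_monom_eq diff_conv_add_uminus zero_neq_one)
    then show "lead_coeff (cyc_poly n) = 1"
      by (simp add: cyc_poly_def n_def)
  qed
  have "q = 0"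
  proof (rule ccontr)
    assume "q \<noteq> 0"
    then have "coeff h (n + degree q) \<noteq> 0"
      using coeff_mult_degree_sum[of "cyc_poly n" q] deg lc q by simp
    then have "n + degree q \<le> degree h"
      by (rule le_degree)
    then show False
      by (simp add: n_def)
  qed
  then have "coeff h i = 0" for i
    using q by simp
  then have "(of_int (coeff f i - coeff g i) :: zhat) = 0" for i
    by (simp add: h_def coeff_map_poly)
  then show "f = g"
    unfolding zhat_of_int_eq_0_iff by (intro poly_eqI) simp
qed

(* In a nontrivial ring 0 counts as a zero divisor, so a non-zero-divisor is in particular
   nonzero. *)
definition zero_divisor :: "'a :: comm_ring_1 \<Rightarrow> bool" where
  "zero_divisor a \<longleftrightarrow> (\<exists>b. b \<noteq> 0 \<and> a * b = 0)"

end

theory Submission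
  imports Defs
begin

text \<open>
  Write \<open>X\<close> for the variable, \<open>Z\<close> for the profinite integers, and suppose \<open>f * g = 0\<close> for a
  compatible family \<open>g\<close>.

  The first step replaces \<open>f\<close> by a polynomial \<open>X^m - 1\<close>.  The common factor of \<open>f\<close> and \<open>X^N - 1\<close>
  over the rationals grows with \<open>N\<close> in the divisibility order, but its degree is bounded by that
  of \<open>f\<close>; hence above any given level \<open>n\<close> there is a level \<open>m\<close> from which on it is stationary, and
  from there on it divides \<open>X^m - 1\<close>.  Clearing denominators in Bezout's identity, or arguing with
  pseudo-division and elements of least degree in place of common factors, some nonzero
  integer multiple of \<open>X^m - 1\<close> lies in the ideal \<open>(f, X^N - 1)\<close> of integer polynomials for every
  multiple \<open>N\<close> of \<open>m\<close> (\<open>cyclic_ideal_stabilises\<close>).  The quotients of \<open>Z[X]\<close> by a monic polynomial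
  are torsion-free because \<open>Z\<close> is, so \<open>X^m - 1\<close> kills \<open>g\<close> at all levels \<open>N\<close> above \<open>m\<close>.

  The second step shows that such a family vanishes at level \<open>m\<close>
  (\<open>annihilated_family_vanishes\<close>).  At level \<open>N = m * k\<close> it is a multiple of the norm element
  \<open>1 + X^m + ... + X^(m * (k - 1))\<close>, which becomes the integer \<open>k\<close> at level \<open>m\<close>.  So \<open>g\<close> at level
  \<open>m\<close> is divisible by every positive integer, and the only such element is zero because
  the same holds in \<open>Z\<close>.  Since \<open>n\<close> divides \<open>m\<close>, the family also vanishes at level \<open>n\<close>.
\<close>

section \<open>Torsion and divisible elements in the profinite integers\<close>

lemma zhat_rel_refl_iff: "zhat_rel x x \<longleftrightarrow> zhat_family x"
  by (simp add: zhat_rel_def)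

lemma zhat_exhaust:
  obtains x where "zhat_family x" "a = abs_zhat x"
proof
  show "a = abs_zhat (rep_zhat a)"
    by (simp add: Quotient_abs_rep[OF Quotient_zhat])
  show "zhat_family (rep_zhat a)"
    using Quotient_rep_reflp[OF Quotient_zhat] zhat_rel_refl_iff by blast
qed

lemma abs_zhat_eq_iff:
  assumes "zhat_family x" "zhat_family y"
  shows "abs_zhat x = abs_zhat y \<longleftrightarrow> (\<forall>n>0. [x n = y n] (mod int n))"
  using Quotient_rel[OF Quotient_zhat, of x y] assms by (auto simp: zhat_rel_def)

lemma zhat_family_const: "zhat_family (\<lambda>_. k)"
  by (simp add: zhat_family_def)

lemma zhat_family_mult:
  "zhat_family x \<Longrightarrow> zhat_family y \<Longrightarrow> zhat_family (\<lambda>n. x n * y n)"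
  by (simp add: zhat_family_def cong_mult)

lemma of_nat_zhat: "of_nat k = abs_zhat (\<lambda>_. int k)"
proof (induction k)
  case 0
  show ?case by (simp add: zero_zhat_def)
next
  case (Suc k)
  then show ?case
    by (simp add: one_zhat_def plus_zhat.abs_eq zhat_rel_refl_iff zhat_family_const)
qed

lemma of_int_zhat: "of_int k = abs_zhat (\<lambda>_. k)"
  by (cases k rule: int_cases2)
    (simp_all add: of_nat_zhat uminus_zhat.abs_eq zhat_rel_refl_iff zhat_family_const)

lemma of_int_mult_abs_zhat:
  "zhat_family x \<Longrightarrow> of_int k * abs_zhat x = abs_zhat (\<lambda>n. k * x n)"
  by (simp add: of_int_zhat times_zhat.abs_eq zhat_rel_refl_iff zhat_family_const)

text \<open>
  Division by \<open>c\<close> costs a factor \<open>c\<close> in the modulus, and the value at \<open>n\<close> is already determined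
  by the one at \<open>n * \<bar>c\<bar>\<close>.
\<close>

lemma zhat_torsion_free:
  fixes a :: zhat
  assumes "of_int c * a = 0" "c \<noteq> 0"
  shows "a = 0"
proof -
  obtain x where x: "zhat_family x" "a = abs_zhat x"
    by (rule zhat_exhaust)
  have "abs_zhat (\<lambda>n. c * x n) = abs_zhat (\<lambda>_. 0)"
    using assms(1) x by (simp add: of_int_mult_abs_zhat zero_zhat_def)
  then have zero: "[c * x n = 0] (mod int n)" if "n > 0" for n
    using that x zhat_family_mult[OF zhat_family_const x(1), of c]
    by (simp add: abs_zhat_eq_iff zhat_family_const)
  have "[x n = 0] (mod int n)" if "n > 0" for n
  proof -
    define N where "N = n * nat \<bar>c\<bar>"
    have "N > 0" "n dvd N"
      using that assms(2) by (simp_all add: N_def)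
    have "c * int n dvd int N"
      by (simp add: N_def mult.commute mult_dvd_mono)
    also have "int N dvd c * x N"
      using zero[OF \<open>N > 0\<close>] by (simp add: cong_0_iff)
    finally have "c * int n dvd c * x N" .
    then have "[x N = 0] (mod int n)"
      using assms(2) by (simp add: cong_0_iff)
    moreover have "[x N = x n] (mod int n)"
      using x(1) \<open>N > 0\<close> \<open>n dvd N\<close> that by (auto simp: zhat_family_def)
    ultimately show ?thesis
      using cong_sym cong_trans by blast
  qed
  then show ?thesis
    using x by (simp add: zero_zhat_def abs_zhat_eq_iff zhat_family_const)
qed

text \<open>Divisibility by \<open>n\<close> alone already makes the residue at \<open>n\<close> vanish.\<close>

lemma zhat_divisible_eq_0:
  fixes a :: zhat
  assumes "\<And>k. k > 0 \<Longrightarrow> of_nat k dvd a"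
  shows "a = 0"
proof -
  obtain x where x: "zhat_family x" "a = abs_zhat x"
    by (rule zhat_exhaust)
  have "[x n = 0] (mod int n)" if "n > 0" for n
  proof -
    obtain b where "a = of_nat n * b"
      using assms[OF \<open>n > 0\<close>] ..
    moreover obtain y where y: "zhat_family y" "b = abs_zhat y"
      by (rule zhat_exhaust)
    ultimately have "abs_zhat x = abs_zhat (\<lambda>i. int n * y i)"
      using x of_int_mult_abs_zhat[of y "int n"] by simp
    then have "[x n = int n * y n] (mod int n)"
      using x that zhat_family_mult[OF zhat_family_const y(1), of "int n"]
      by (simp add: abs_zhat_eq_iff)
    then show ?thesis
      by (simp add: cong_def)
  qed
  then show ?thesis
    using x by (simp add: zero_zhat_def abs_zhat_eq_iff zhat_family_const)
qed

section \<open>Quotients by a monic polynomial over a commutative ring\<close>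

lemma monic_dvd_small_degree:
  fixes p r :: "'a :: comm_ring_1 poly"
  assumes "lead_coeff p = 1" "p dvd r" "r = 0 \<or> degree r < degree p"
  shows "r = 0"
proof (rule ccontr)
  assume "r \<noteq> 0"
  obtain q where q: "r = p * q"
    using assms(2) ..
  then have "coeff r (degree p + degree q) = lead_coeff q"
    using assms(1) coeff_mult_degree_sum[of p q] by simp
  moreover have "q \<noteq> 0"
    using q \<open>r \<noteq> 0\<close> by auto
  ultimately have "degree p + degree q \<le> degree r"
    by (intro le_degree) simp
  then show False
    using assms(3) \<open>r \<noteq> 0\<close> by simp
qed

lemma monic_mult_eq_0:
  fixes p q :: "'a :: comm_ring_1 poly"
  assumes "lead_coeff p = 1" "p * q = 0"
  shows "q = 0"
  using coeff_mult_degree_sum[of p q] assms by simp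

lemma monic_division:
  fixes p f :: "'a :: comm_ring_1 poly"
  assumes "lead_coeff p = 1"
  obtains q r where "f = p * q + r" "r = 0 \<or> degree r < degree p"
proof -
  obtain q r where "pseudo_divmod f p = (q, r)"
    by fastforce
  moreover have "p \<noteq> 0"
    using assms by auto
  ultimately show thesis
    using that pseudo_divmod[of p f q r] assms by simp
qed

text \<open>
  The quotient is free over the base ring, remainders serving as coordinates; so torsion and
  divisibility can be tested coefficientwise on remainders.
\<close>

lemma monic_dvd_smult_cancel:
  fixes p f :: "'a :: comm_ring_1 poly"
  assumes monic: "lead_coeff p = 1"
    and c: "\<And>x. c * x = 0 \<Longrightarrow> x = 0"
    and dvd: "p dvd smult c f"
  shows "p dvd f"
proof -
  obtain q r where f: "f = p * q + r" and r: "r = 0 \<or> degree r < degree p"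
    using monic_division[OF monic] .
  have "p dvd smult c f - p * smult c q"
    using dvd dvd_triv_left by (rule dvd_diff)
  then have "p dvd smult c r"
    by (simp add: f smult_add_right)
  moreover have "smult c r = 0 \<or> degree (smult c r) < degree p"
    using r degree_smult_le[of c r] by auto
  ultimately have "smult c r = 0"
    by (rule monic_dvd_small_degree[OF monic])
  then have "c * coeff r i = 0" for i
    by (metis coeff_0 coeff_smult)
  then have "r = 0"
    using c by (intro poly_eqI) simp
  then show ?thesis
    by (simp add: f)
qed

lemma monic_dvd_if_divisible_mod:
  fixes p f :: "'a :: comm_ring_1 poly"
  assumes monic: "lead_coeff p = 1"
    and C: "\<And>x. (\<And>c. c \<in> C \<Longrightarrow> c dvd x) \<Longrightarrow> x = 0"
    and div: "\<And>c. c \<in> C \<Longrightarrow> \<exists>q. p dvd f - smult c q"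
  shows "p dvd f"
proof -
  obtain q r where f: "f = p * q + r" and r: "r = 0 \<or> degree r < degree p"
    using monic_division[OF monic] .
  have "c dvd coeff r i" if "c \<in> C" for c i
  proof -
    obtain h where h: "p dvd f - smult c h"
      using div \<open>c \<in> C\<close> by blast
    obtain q' r' where h': "h = p * q' + r'" and r': "r' = 0 \<or> degree r' < degree p"
      using monic_division[OF monic] .
    have "r - smult c r' = (f - smult c h) - p * (q - smult c q')"
      by (simp add: f h' algebra_simps smult_add_right)
    then have "p dvd r - smult c r'"
      using h by simp
    moreover have "r - smult c r' = 0 \<or> degree (r - smult c r') < degree p"
    proof (cases "r = 0 \<and> r' = 0")
      case False
      then have "0 < degree p"
        using r r' by auto
      then have "degree r < degree p" "degree (smult c r') < degree p"
        using r r' degree_smult_le[of c r'] by auto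
      then show ?thesis
        by (simp add: degree_diff_less)
    qed simp
    ultimately have "r - smult c r' = 0"
      by (rule monic_dvd_small_degree[OF monic])
    then show ?thesis
      by simp
  qed
  then have "r = 0"
    using C by (intro poly_eqI) simp
  then show ?thesis
    by (simp add: f)
qed

section \<open>Ideals \<open>(f, X^N - 1)\<close> over an integral domain\<close>

definition pair_ideal :: "'a :: comm_ring_1 \<Rightarrow> 'a \<Rightarrow> 'a set" where
  "pair_ideal f h = {a * f + b * h | a b. True}"

lemma pair_ideal_diff:
  assumes "p \<in> pair_ideal f h" "q \<in> pair_ideal f h"
  shows "p - q \<in> pair_ideal f h"
proof -
  obtain a b a' b' where "p = a * f + b * h" "q = a' * f + b' * h"
    using assms by (auto simp: pair_ideal_def)
  then have "p - q = (a - a') * f + (b - b') * h"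
    by (simp add: algebra_simps)
  then show ?thesis
    by (auto simp: pair_ideal_def)
qed

lemma pair_ideal_mult:
  assumes "p \<in> pair_ideal f h"
  shows "q * p \<in> pair_ideal f h"
proof -
  obtain a b where "p = a * f + b * h"
    using assms by (auto simp: pair_ideal_def)
  then have "q * p = (q * a) * f + (q * b) * h"
    by (simp add: algebra_simps)
  then show ?thesis
    unfolding pair_ideal_def by blast
qed

lemma pair_ideal_left: "f \<in> pair_ideal f h"
  unfolding pair_ideal_def by (rule CollectI, rule exI[of _ 1], rule exI[of _ 0]) simp

lemma pair_ideal_right: "h \<in> pair_ideal f h"
  unfolding pair_ideal_def by (rule CollectI, rule exI[of _ 0], rule exI[of _ 1]) simp

lemma pair_ideal_mono:
  assumes "h dvd h'"
  shows "pair_ideal f h' \<subseteq> pair_ideal f h"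
proof
  fix p assume "p \<in> pair_ideal f h'"
  then obtain a b where "p = a * f + b * h'"
    by (auto simp: pair_ideal_def)
  moreover obtain k where "h' = h * k"
    using assms ..
  ultimately have "p = a * f + (b * k) * h"
    by (simp add: algebra_simps)
  then show "p \<in> pair_ideal f h"
    unfolding pair_ideal_def by blast
qed

text \<open>
  A nonzero element of least degree generates the ideal over the fraction field; pseudo-division
  keeps everything over the base ring.
\<close>

lemma least_degree_generates_up_to_scalar:
  fixes f h d p :: "'a :: idom poly"
  assumes d: "d \<in> pair_ideal f h" "d \<noteq> 0"
    and least: "\<And>e. e \<in> pair_ideal f h \<Longrightarrow> e \<noteq> 0 \<Longrightarrow> degree d \<le> degree e"
    and p: "p \<in> pair_ideal f h"
  obtains c q where "c \<noteq> 0" "smult c p = q * d"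
proof -
  obtain c q where "c \<noteq> 0" and *: "smult c p = d * q + pseudo_mod p d"
    using pseudo_mod(1)[OF d(2)] by blast
  have "[:c:] * p - q * d \<in> pair_ideal f h"
    using p d(1) by (intro pair_ideal_diff pair_ideal_mult)
  then have "pseudo_mod p d \<in> pair_ideal f h"
    using * by (simp add: mult.commute)
  then have "pseudo_mod p d = 0"
    using least[of "pseudo_mod p d"] pseudo_mod(2)[OF d(2), of p] by force
  then show thesis
    using that[of c q] \<open>c \<noteq> 0\<close> * by (simp add: mult.commute)
qed

definition least_degree :: "'a :: zero poly set \<Rightarrow> nat" where
  "least_degree I = (LEAST k. \<exists>d\<in>I. d \<noteq> 0 \<and> degree d = k)"

lemma least_degree_le: "d \<in> I \<Longrightarrow> d \<noteq> 0 \<Longrightarrow> least_degree I \<le> degree d"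
  unfolding least_degree_def by (rule Least_le) blast

lemma least_degree_attained:
  assumes "p \<in> I" "p \<noteq> 0"
  obtains d where "d \<in> I" "d \<noteq> 0" "degree d = least_degree I"
  using LeastI[of "\<lambda>k. \<exists>d\<in>I. d \<noteq> 0 \<and> degree d = k" "degree p"] assms
  unfolding least_degree_def by blast

lemma monom_diff_1_factor:
  "monom (1 :: 'a :: comm_ring_1) (m * k) - 1 = (monom 1 m - 1) * (\<Sum>i<k. monom 1 m ^ i)"
proof -
  have "monom (1 :: 'a) (m * k) = monom 1 m ^ k"
    by (simp add: monom_power)
  then show ?thesis
    by (simp add: power_diff_1_eq)
qed

text \<open>
  As \<open>N\<close> increases in the divisibility order, the ideals \<open>(f, X^N - 1)\<close> shrink and their least
  degrees increase, bounded by the degree of \<open>f\<close>.  At a level \<open>m\<close> where the least degree is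
  maximal, a least-degree element of any later ideal is a least-degree element of the ideal at
  \<open>m\<close> too, and so divides a nonzero constant multiple of
  \<open>X^m - 1\<close>.
\<close>

lemma cyclic_ideal_stabilises:
  fixes f :: "'a :: idom poly"
  assumes "f \<noteq> 0" "n > 0"
  obtains m where "m > 0" "n dvd m"
    "\<And>N. N > 0 \<Longrightarrow> m dvd N \<Longrightarrow>
       \<exists>c a b. c \<noteq> 0 \<and> smult c (monom 1 m - 1) = a * f + b * (monom 1 N - 1)"
proof -
  define I where "I N = pair_ideal f (monom 1 N - 1)" for N
  have f_in: "f \<in> I N" for N
    by (simp add: I_def pair_ideal_left)
  have "\<exists>m. (m > 0 \<and> n dvd m) \<and>
      (\<forall>N. N > 0 \<and> n dvd N \<longrightarrow> least_degree (I N) \<le> least_degree (I m))"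
    using assms(2) least_degree_le[OF f_in assms(1)]
    by (intro ex_has_greatest_nat[where k = n and b = "Suc (degree f)"]) (auto simp: less_Suc_eq_le)
  then obtain m where m: "m > 0" "n dvd m"
    and max: "\<And>N. N > 0 \<Longrightarrow> n dvd N \<Longrightarrow> least_degree (I N) \<le> least_degree (I m)"
    by blast
  have "\<exists>c a b. c \<noteq> 0 \<and> smult c (monom 1 m - 1) = a * f + b * (monom 1 N - 1)"
    if N: "N > 0" "m dvd N" for N
  proof -
    obtain d where d: "d \<in> I N" "d \<noteq> 0" "degree d = least_degree (I N)"
      using least_degree_attained[OF f_in assms(1)] .
    have "I N \<subseteq> I m"
      using N(2) unfolding I_def by (intro pair_ideal_mono) (auto simp: monom_diff_1_factor)
    then have "d \<in> pair_ideal f (monom 1 m - 1)"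
      using d(1) by (auto simp: I_def)
    moreover have "degree d \<le> degree e" if "e \<in> pair_ideal f (monom 1 m - 1)" "e \<noteq> 0" for e
      using that d(3) max[of N] N m(2) least_degree_le[of e "I m"]
      by (auto simp: I_def intro: dvd_trans)
    ultimately obtain c q where c: "c \<noteq> 0" "smult c (monom 1 m - 1) = q * d"
      using least_degree_generates_up_to_scalar[OF _ d(2) _ pair_ideal_right] by blast
    moreover have "q * d \<in> pair_ideal f (monom 1 N - 1)"
      using d(1) by (simp add: I_def pair_ideal_mult)
    then obtain a b where "q * d = a * f + b * (monom 1 N - 1)"
      by (auto simp: pair_ideal_def)
    ultimately show ?thesis
      by metis
  qed
  then show thesis
    using that m by blast
qed

section \<open>Compatible families annihilated by a cyclic polynomial\<close>

lemma lead_coeff_cyc_poly: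
  assumes "n > 0"
  shows "lead_coeff (cyc_poly n) = 1"
proof -
  have "degree (- 1 :: zhat poly) < degree (monom 1 n :: zhat poly)"
    using assms by (simp add: degree_monom_eq)
  then have "degree (cyc_poly n) = n"
    unfolding cyc_poly_def
    by (metis degree_add_eq_left degree_monom_eq diff_conv_add_uminus zero_neq_one)
  then show ?thesis
    using assms by (simp add: cyc_poly_def)
qed

lemma cyc_poly_dvd_power_diff: "cyc_poly m dvd monom 1 m ^ i - 1"
  by (simp add: cyc_poly_def power_diff_1_eq)

text \<open>
  Being fixed by multiplication with \<open>X^m\<close> at level \<open>m * k\<close> forces a factor \<open>norm_elt\<close>, and
  each of the \<open>k\<close> summands of \<open>norm_elt\<close> becomes \<open>1\<close> at level \<open>m\<close>.  Letting \<open>k\<close> vary makes the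
  value at level \<open>m\<close> infinitely divisible.
\<close>

lemma annihilated_family_vanishes:
  assumes g: "cgr_family g" and "m > 0"
    and ann: "\<And>N. N > 0 \<Longrightarrow> m dvd N \<Longrightarrow> cyc_poly N dvd cyc_poly m * g N"
  shows "cyc_poly m dvd g m"
proof (rule monic_dvd_if_divisible_mod[where C = "of_nat ` {0<..}"])
  show "lead_coeff (cyc_poly m) = 1"
    using \<open>m > 0\<close> by (rule lead_coeff_cyc_poly)
  show "x = 0" if "\<And>c. c \<in> of_nat ` {0<..} \<Longrightarrow> c dvd x" for x :: zhat
    using that by (intro zhat_divisible_eq_0) auto
  fix c :: zhat
  assume "c \<in> of_nat ` {0<..}"
  then obtain k where k: "k > 0" "c = of_nat k"
    by auto
  define norm_elt :: "zhat poly" where "norm_elt = (\<Sum>i<k. monom 1 m ^ i)"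
  have "m * k > 0"
    using \<open>m > 0\<close> k by simp
  then obtain q where "cyc_poly m * g (m * k) = cyc_poly (m * k) * q"
    using ann[of "m * k"] by auto
  moreover have "cyc_poly (m * k) = cyc_poly m * norm_elt"
    by (simp only: cyc_poly_def monom_diff_1_factor norm_elt_def)
  ultimately have "cyc_poly m * (g (m * k) - norm_elt * q) = 0"
    by (simp add: right_diff_distrib mult.assoc)
  then have top: "g (m * k) = norm_elt * q"
    using monic_mult_eq_0[OF lead_coeff_cyc_poly[OF \<open>m > 0\<close>]] by (metis eq_iff_diff_eq_0)
  have "norm_elt - of_nat k = (\<Sum>i<k. monom 1 m ^ i - 1)"
    by (simp add: norm_elt_def sum_subtractf)
  also have "cyc_poly m dvd \<dots>"
    by (intro dvd_sum cyc_poly_dvd_power_diff)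
  finally have "cyc_poly m dvd (norm_elt - of_nat k) * q"
    by simp
  moreover have "cyc_poly m dvd g (m * k) - g m"
    using g \<open>m > 0\<close> \<open>m * k > 0\<close> by (auto simp: cgr_family_def)
  ultimately have "cyc_poly m dvd (norm_elt - of_nat k) * q - (g (m * k) - g m)"
    by (rule dvd_diff)
  also have "(norm_elt - of_nat k) * q - (g (m * k) - g m) = g m - smult c q"
    by (simp add: top k of_nat_poly left_diff_distrib)
  finally show "\<exists>q. cyc_poly m dvd g m - smult c q"
    by blast
qed

section \<open>Nonzero integer polynomials\<close>

lemma map_poly_of_int_add:
  "map_poly of_int (f + g) = (map_poly of_int f + map_poly of_int g :: 'a :: comm_ring_1 poly)"
  by (rule poly_eqI) (simp add: coeff_map_poly)

lemma map_poly_of_int_mult: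
  "map_poly of_int (f * g) = (map_poly of_int f * map_poly of_int g :: 'a :: comm_ring_1 poly)"
  by (rule poly_eqI) (simp add: coeff_map_poly coeff_mult)

lemma map_poly_of_int_smult_cyc_poly:
  "map_poly of_int (smult c (monom 1 n - 1)) = smult (of_int c) (cyc_poly n)"
  by (rule poly_eqI) (simp add: coeff_map_poly cyc_poly_def coeff_1 flip: monom_0)

lemma annihilated_by_cyc_poly:
  assumes "N > 0"
    and ann: "cyc_poly N dvd map_poly of_int f * h"
    and "c \<noteq> 0" and comb: "smult c (monom 1 m - 1) = a * f + b * (monom 1 N - 1)"
  shows "cyc_poly N dvd cyc_poly m * h"
proof (rule monic_dvd_smult_cancel)
  show "lead_coeff (cyc_poly N) = 1"
    using \<open>N > 0\<close> by (rule lead_coeff_cyc_poly)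
  show "x = 0" if "of_int c * x = 0" for x :: zhat
    using that \<open>c \<noteq> 0\<close> by (rule zhat_torsion_free)
  have "smult (of_int c) (cyc_poly m)
      = map_poly of_int a * map_poly of_int f + map_poly of_int b * cyc_poly N"
    using arg_cong[OF comb, of "map_poly of_int :: _ \<Rightarrow> zhat poly"]
      map_poly_of_int_smult_cyc_poly[of 1 N]
    by (simp add: map_poly_of_int_smult_cyc_poly map_poly_of_int_add map_poly_of_int_mult)
  then have "smult (of_int c) (cyc_poly m) * h
      = map_poly of_int a * (map_poly of_int f * h) + cyc_poly N * (map_poly of_int b * h)"
    by (simp only: algebra_simps)
  then show "cyc_poly N dvd smult (of_int c) (cyc_poly m * h)"
    using ann by (simp add: mult_smult_left)
qed

theorem lemma3p3:
  fixes f :: "int poly"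
  assumes "f \<noteq> 0"
  shows "\<not> zero_divisor (cgr_of_int_poly f)"
proof -
  have "b = 0" if zero: "cgr_of_int_poly f * b = 0" for b
  proof -
    define g where "g = rep_zhat_cgr b"
    have "cgr_rel g g"
      unfolding g_def by (rule Quotient_rep_reflp[OF Quotient_zhat_cgr])
    then have g: "cgr_family g"
      by (simp add: cgr_rel_def)
    have b: "b = abs_zhat_cgr g"
      by (simp add: g_def Quotient_abs_rep[OF Quotient_zhat_cgr])
    have "cgr_of_int_poly f * b = abs_zhat_cgr (\<lambda>n. map_poly of_int f * g n)"
      by (simp add: cgr_of_int_poly_eq b times_zhat_cgr.abs_eq cgr_rel_const \<open>cgr_rel g g\<close>)
    moreover have "cgr_rel (\<lambda>n. map_poly of_int f * g n) (\<lambda>n. map_poly of_int f * g n)"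
      using g by (simp add: cgr_rel_def cgr_family_def dvd_mult_diff)
    ultimately have "cgr_rel (\<lambda>n. map_poly of_int f * g n) (\<lambda>_. 0)"
      using zero cgr_rel_const Quotient_rel[OF Quotient_zhat_cgr]
      unfolding zero_zhat_cgr_def by metis
    then have ann: "cyc_poly N dvd map_poly of_int f * g N" if "N > 0" for N
      using that by (simp add: cgr_rel_def)
    have "cyc_poly n dvd g n" if "n > 0" for n
    proof -
      obtain m where m: "m > 0" "n dvd m"
        and comb: "\<And>N. N > 0 \<Longrightarrow> m dvd N \<Longrightarrow>
          \<exists>c a b. c \<noteq> 0 \<and> smult c (monom 1 m - 1) = a * f + b * (monom 1 N - 1)"
        using cyclic_ideal_stabilises[OF assms \<open>n > 0\<close>] by blast
      have "cyc_poly m dvd g m"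
        using g m(1)
      proof (rule annihilated_family_vanishes)
        show "cyc_poly N dvd cyc_poly m * g N" if "N > 0" "m dvd N" for N
          using comb[OF that] annihilated_by_cyc_poly[OF that(1) ann[OF that(1)]] by blast
      qed
      moreover have "cyc_poly n dvd cyc_poly m"
        using m(2) by (auto simp: cyc_poly_def monom_diff_1_factor)
      ultimately have "cyc_poly n dvd g m"
        by (rule dvd_trans[rotated])
      moreover have "cyc_poly n dvd g m - g n"
        using g m \<open>n > 0\<close> by (simp add: cgr_family_def)
      ultimately have "cyc_poly n dvd g m - (g m - g n)"
        by (rule dvd_diff)
      then show ?thesis
        by simp
    qed
    then have "cgr_rel g (\<lambda>_. 0)"
      using g by (simp add: cgr_rel_def cgr_family_def)
    then show "b = 0"
      using Quotient_rel_abs[OF Quotient_zhat_cgr] by (simp add: b zero_zhat_cgr_def)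
  qed
  then show ?thesis
    by (auto simp: zero_divisor_def)
qed

end
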